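(* Assume that $S\colon U\to Y$ is weak-to-weak continuous, i.e., $u_i\rightharpoonup u$ in $U$ implies $S(u_i)\rightharpoonup S(u)$ in $Y$. Then the problem $$\min_{u\in U}\ \mathcal E(u),\qquad \mathcal E(u)=\frac12\|S(u)-z\|_Y^2+\int_\Omega g(u(x))\,\mathrm dx,$$ has a solution $\bar u\in U$.
   Context: $\Omega\subset\mathbb R^n$ is a bounded open domain, $m\ge 2$, $U=L^2(\Omega;\mathbb R^m)$, $Y$ is a (real) Hilbert space, $z\in Y$, and $S\colon U\to Y$ is a (possibly nonlinear) operator. $\mathcal M\subset\mathbb R^m$ is a finite set and $g\colon\mathbb R^m\to\mathbb R\cup\{\infty\}$ is proper, convex, and lower semi-continuous with $\operatorname{dom} g=\operatorname{co}\mathcal M$ (the convex hull of $\mathcal M$). Weak-to-weak continuity is understood for sequences. *)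

theory Defs
  imports "HOL-Analysis.Analysis"
begin

text \<open>
  The elements of \<open>L\<^sup>2(\<Omega>; \<real>\<^sup>m)\<close> are represented by functions; two functions that agree
  almost everywhere on \<open>\<Omega>\<close> represent the same element. Values outside \<open>\<Omega>\<close> are irrelevant.
\<close>

definition L2 :: "('a::euclidean_space) set \<Rightarrow> ('a \<Rightarrow> 'b::euclidean_space) set" where
  "L2 \<Omega> = {u. u \<in> borel_measurable (lebesgue_on \<Omega>) \<and>
              integrable (lebesgue_on \<Omega>) (\<lambda>x. (norm (u x))\<^sup>2)}"

definition L2_norm :: "('a::euclidean_space) set \<Rightarrow> ('a \<Rightarrow> 'b::euclidean_space) \<Rightarrow> real" where
  "L2_norm \<Omega> u = sqrt (LINT x|lebesgue_on \<Omega>. (norm (u x))\<^sup>2)"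

text \<open>
  A map on \<open>L\<^sup>2\<close> is one that does not distinguish representatives of the same class.
\<close>

definition L2_respects :: "('a::euclidean_space) set \<Rightarrow> (('a \<Rightarrow> 'b::euclidean_space) \<Rightarrow> 'c) \<Rightarrow> bool" where
  "L2_respects \<Omega> F \<longleftrightarrow>
     (\<forall>u\<in>L2 \<Omega>. \<forall>v\<in>L2 \<Omega>. (AE x in lebesgue_on \<Omega>. u x = v x) \<longrightarrow> F u = F v)"

text \<open>
  The bounded linear functionals on \<open>L\<^sup>2\<close>. Linearity and boundedness make them respect almost
  everywhere equality, so \<^const>\<open>L2_respects\<close> need not be required.
\<close>

definition L2_dual :: "('a::euclidean_space) set \<Rightarrow> (('a \<Rightarrow> 'b::euclidean_space) \<Rightarrow> real) set" where
  "L2_dual \<Omega> = {\<phi>.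
     (\<forall>u\<in>L2 \<Omega>. \<forall>v\<in>L2 \<Omega>. \<phi> (\<lambda>x. u x + v x) = \<phi> u + \<phi> v) \<and>
     (\<forall>c. \<forall>u\<in>L2 \<Omega>. \<phi> (\<lambda>x. c *\<^sub>R u x) = c * \<phi> u) \<and>
     (\<exists>C. \<forall>u\<in>L2 \<Omega>. \<bar>\<phi> u\<bar> \<le> C * L2_norm \<Omega> u)}"

definition L2_weak_tendsto ::
  "('a::euclidean_space) set \<Rightarrow> (nat \<Rightarrow> 'a \<Rightarrow> 'b::euclidean_space) \<Rightarrow> ('a \<Rightarrow> 'b) \<Rightarrow> bool" where
  "L2_weak_tendsto \<Omega> us u \<longleftrightarrow>
     (\<forall>i. us i \<in> L2 \<Omega>) \<and> u \<in> L2 \<Omega> \<and> (\<forall>\<phi>\<in>L2_dual \<Omega>. (\<lambda>i. \<phi> (us i)) \<longlonglongrightarrow> \<phi> u)"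

definition weak_tendsto :: "(nat \<Rightarrow> 'y::real_normed_vector) \<Rightarrow> 'y \<Rightarrow> bool" where
  "weak_tendsto ys y \<longleftrightarrow>
     (\<forall>\<phi> :: 'y \<Rightarrow> real. bounded_linear \<phi> \<longrightarrow> (\<lambda>i. \<phi> (ys i)) \<longlonglongrightarrow> \<phi> y)"

definition weak_to_weak_continuous ::
  "('a::euclidean_space) set \<Rightarrow> (('a \<Rightarrow> 'b::euclidean_space) \<Rightarrow> 'y::real_normed_vector) \<Rightarrow> bool" where
  "weak_to_weak_continuous \<Omega> S \<longleftrightarrow>
     (\<forall>us u. L2_weak_tendsto \<Omega> us u \<longrightarrow> weak_tendsto (\<lambda>i. S (us i)) (S u))"

definition edom :: "('b \<Rightarrow> ereal) \<Rightarrow> 'b set" where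
  "edom g = {x. g x < \<infinity>}"

definition proper_fun :: "('b \<Rightarrow> ereal) \<Rightarrow> bool" where
  "proper_fun g \<longleftrightarrow> (\<forall>x. g x \<noteq> -\<infinity>) \<and> edom g \<noteq> {}"

definition convex_fun :: "('b::real_vector \<Rightarrow> ereal) \<Rightarrow> bool" where
  "convex_fun g \<longleftrightarrow> (\<forall>x y t. 0 < t \<and> t < 1 \<longrightarrow>
     g ((1 - t) *\<^sub>R x + t *\<^sub>R y) \<le> ereal (1 - t) * g x + ereal t * g y)"

definition lsc_fun :: "('b::topological_space \<Rightarrow> ereal) \<Rightarrow> bool" where
  "lsc_fun g \<longleftrightarrow> (\<forall>x. g x \<le> Liminf (at x) g)"

text \<open>
  The extended Lebesgue integral, positive part minus negative part; \<^const>\<open>e2ennreal\<close> maps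
  negative arguments to 0. It is only used below when the negative part has a finite integral, so
  the value that \<^typ>\<open>ereal\<close> assigns to \<open>\<infinity> - \<infinity>\<close> plays no role.
\<close>

definition ereal_integral :: "'a measure \<Rightarrow> ('a \<Rightarrow> ereal) \<Rightarrow> ereal" where
  "ereal_integral M f =
     enn2ereal (\<integral>\<^sup>+ x. e2ennreal (f x) \<partial>M) - enn2ereal (\<integral>\<^sup>+ x. e2ennreal (- f x) \<partial>M)"

definition energy ::
  "('a::euclidean_space) set \<Rightarrow> (('a \<Rightarrow> 'b::euclidean_space) \<Rightarrow> 'y::real_normed_vector) \<Rightarrow> 'y \<Rightarrow>
   ('b \<Rightarrow> ereal) \<Rightarrow> ('a \<Rightarrow> 'b) \<Rightarrow> ereal" where
  "energy \<Omega> S z g u =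
     ereal (1 / 2 * (norm (S u - z))\<^sup>2) + ereal_integral (lebesgue_on \<Omega>) (\<lambda>x. g (u x))"

end

theory Submission
  imports Defs "HOL-Library.Diagonal_Subsequence"
begin

text \<open>
  This is the direct method of the calculus of variations. A minimising sequence \<open>u\<^sub>i\<close> takes its
  values in the polytope \<open>dom g\<close> almost everywhere, so it is bounded in \<open>L\<^sup>2\<close> and has a weakly
  convergent subsequence. Its weak limit \<open>w\<close> is a minimiser because both terms of the energy
  are weakly sequentially lower semicontinuous: the first because \<open>S\<close> is weak-to-weak continuous
  and the norm of \<open>Y\<close> is weakly lower semicontinuous, the second because \<open>g\<close> is convex and lower
  semicontinuous.

  The weak compactness of \<open>L\<^sup>2\<close> is obtained in a form that gives the second semicontinuity at the
  same time. By the parallelogram law, elements of almost minimal norm in the convex hulls of the tails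
  \<open>{u\<^sub>i. i \<ge> n}\<close> form a Cauchy sequence, and so have a strong limit \<open>w\<close>
  (\<open>tail_hull_strong_limit\<close>). A bounded functional \<open>\<phi>\<close> whose values \<open>\<phi> u\<^sub>i\<close> converge has the same
  limit along elements of these hulls, hence \<open>\<phi> w = lim \<phi> u\<^sub>i\<close>
  (\<open>dual_limit_unique\<close>). If the inner products \<open>\<langle>u\<^sub>i, u\<^sub>j\<rangle>\<close> converge for every \<open>j\<close>, which a
  diagonal subsequence achieves, then all subsequences lead to the same \<open>w\<close>
  (\<open>gram_determines_limit\<close>), and therefore \<open>\<phi> u\<^sub>i\<close> converges for all \<open>\<phi>\<close>.

  The limit \<open>w\<close> is thus the strong limit of convex combinations of the tails, as in Mazur's lemma.
  Convexity bounds the integral of \<open>g\<close> along these combinations by its supremum over the tail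
  (\<open>nn_integral_tail_hull_le\<close>), and Fatou's lemma along an almost everywhere convergent subsequence
  carries the bound over to \<open>w\<close> (\<open>nn_integral_le_of_norm_sq_limit\<close>). Fatou's lemma needs a nonnegative
  integrand; \<open>g\<close> is bounded below, since a lower semicontinuous function attains its
  minimum on a compact set, and a constant shift of \<open>g\<close> changes the energy only by a constant
  because \<open>\<Omega>\<close> has finite measure.
\<close>

section \<open>Weak sequential compactness in a complete semi-inner product space\<close>

text \<open>
  The convex hull of \<open>{u i | i. n \<le> i}\<close> for the pointwise operations. Closure under binary
  combinations suffices for the existence of midpoints and lets every estimate that is stable
  under convex combinations be proved by rule induction.
\<close>

inductive_set tail_hull :: "(nat \<Rightarrow> 'x \<Rightarrow> 'v::real_vector) \<Rightarrow> nat \<Rightarrow> ('x \<Rightarrow> 'v) set"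
  for u n where
  base: "n \<le> i \<Longrightarrow> u i \<in> tail_hull u n"
| comb: "a \<in> tail_hull u n \<Longrightarrow> b \<in> tail_hull u n \<Longrightarrow> 0 < t \<Longrightarrow> t < 1 \<Longrightarrow>
    (\<lambda>x. (1 - t) *\<^sub>R a x + t *\<^sub>R b x) \<in> tail_hull u n"

lemma tail_hull_antimono:
  assumes "m \<le> n"
  shows "tail_hull u n \<subseteq> tail_hull u m"
proof
  fix c assume "c \<in> tail_hull u n"
  then show "c \<in> tail_hull u m"
    by induction (use assms in \<open>auto intro: tail_hull.intros\<close>)
qed

lemma tail_hull_subseq:
  fixes r :: "nat \<Rightarrow> nat"
  assumes "strict_mono r"
  shows "tail_hull (\<lambda>i. u (r i)) n \<subseteq> tail_hull u n"
proof
  fix c assume "c \<in> tail_hull (\<lambda>i. u (r i)) n"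
  then show "c \<in> tail_hull u n"
  proof induction
    case (base i)
    then have "n \<le> r i" using seq_suble[OF assms, of i] by simp
    then show ?case by (rule tail_hull.base)
  qed (auto intro: tail_hull.comb)
qed

lemma bounded_real_convergent_subseq:
  fixes f :: "nat \<Rightarrow> real"
  assumes "\<And>i. \<bar>f i\<bar> \<le> B"
  obtains l r where "strict_mono (r :: nat \<Rightarrow> nat)" "(\<lambda>i. f (r i)) \<longlonglongrightarrow> l"
proof -
  have "bounded (range f)" using assms by (auto simp: bounded_iff)
  then show ?thesis using bounded_imp_convergent_subsequence[of f] that by (auto simp: o_def)
qed

text \<open>
  The form is only semidefinite, as on functions that are not identified almost everywhere; limits
  are therefore unique only up to elements on which the form vanishes. The carrier is a set
  rather than a type because for \<open>L\<^sup>2\<close> it depends on the domain \<open>\<Omega>\<close>.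
\<close>

locale complete_semi_inner =
  fixes V :: "('x \<Rightarrow> 'v::real_vector) set"
    and ip :: "('x \<Rightarrow> 'v) \<Rightarrow> ('x \<Rightarrow> 'v) \<Rightarrow> real"
  assumes add_closed: "\<lbrakk>u \<in> V; v \<in> V\<rbrakk> \<Longrightarrow> (\<lambda>x. u x + v x) \<in> V"
    and scale_closed: "u \<in> V \<Longrightarrow> (\<lambda>x. c *\<^sub>R u x) \<in> V"
    and ip_add_left: "\<lbrakk>u \<in> V; v \<in> V; w \<in> V\<rbrakk> \<Longrightarrow> ip (\<lambda>x. u x + v x) w = ip u w + ip v w"
    and ip_scale_left: "\<lbrakk>u \<in> V; w \<in> V\<rbrakk> \<Longrightarrow> ip (\<lambda>x. c *\<^sub>R u x) w = c * ip u w"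
    and ip_commute: "\<lbrakk>u \<in> V; v \<in> V\<rbrakk> \<Longrightarrow> ip u v = ip v u"
    and ip_nonneg: "u \<in> V \<Longrightarrow> 0 \<le> ip u u"
    and complete: "\<And>w :: nat \<Rightarrow> 'x \<Rightarrow> 'v. \<lbrakk>\<And>n. w n \<in> V;
        \<And>e. 0 < e \<Longrightarrow> \<exists>N. \<forall>m\<ge>N. \<forall>n\<ge>N. ip (\<lambda>x. w m x - w n x) (\<lambda>x. w m x - w n x) < e\<rbrakk> \<Longrightarrow>
        \<exists>v\<in>V. (\<lambda>n. ip (\<lambda>x. w n x - v x) (\<lambda>x. w n x - v x)) \<longlonglongrightarrow> 0"
begin

definition dual :: "(('x \<Rightarrow> 'v) \<Rightarrow> real) set" where
  "dual = {\<phi>.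
     (\<forall>u\<in>V. \<forall>v\<in>V. \<phi> (\<lambda>x. u x + v x) = \<phi> u + \<phi> v) \<and>
     (\<forall>c. \<forall>u\<in>V. \<phi> (\<lambda>x. c *\<^sub>R u x) = c * \<phi> u) \<and>
     (\<exists>C. \<forall>u\<in>V. \<bar>\<phi> u\<bar> \<le> C * sqrt (ip u u))}"

lemma lin_closed:
  assumes "u \<in> V" "v \<in> V"
  shows "(\<lambda>x. a *\<^sub>R u x + b *\<^sub>R v x) \<in> V"
  by (intro add_closed scale_closed assms)

lemma diff_closed:
  assumes "u \<in> V" "v \<in> V"
  shows "(\<lambda>x. u x - v x) \<in> V"
  using lin_closed[OF assms, of 1 "-1"] by simp

lemma ip_lin_left:
  assumes "u \<in> V" "v \<in> V" "w \<in> V"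
  shows "ip (\<lambda>x. a *\<^sub>R u x + b *\<^sub>R v x) w = a * ip u w + b * ip v w"
  using assms by (simp add: ip_add_left ip_scale_left scale_closed)

lemma ip_lin_self:
  assumes "u \<in> V" "v \<in> V"
  shows "ip (\<lambda>x. a *\<^sub>R u x + b *\<^sub>R v x) (\<lambda>x. a *\<^sub>R u x + b *\<^sub>R v x)
    = a\<^sup>2 * ip u u + 2 * (a * b) * ip u v + b\<^sup>2 * ip v v" (is "ip ?w ?w = _")
proof -
  have w: "?w \<in> V" by (rule lin_closed[OF assms])
  have "ip ?w ?w = a * ip ?w u + b * ip ?w v"
    using ip_lin_left[OF assms w] ip_commute[OF assms(1) w] ip_commute[OF assms(2) w] by simp
  then show ?thesis
    using ip_lin_left[OF assms assms(1)] ip_lin_left[OF assms assms(2)] ip_commute[OF assms]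
    by (simp add: algebra_simps power2_eq_square)
qed

lemma ip_diff_self:
  assumes "u \<in> V" "v \<in> V"
  shows "ip (\<lambda>x. u x - v x) (\<lambda>x. u x - v x) = ip u u - 2 * ip u v + ip v v"
  using ip_lin_self[OF assms, of 1 "-1"] by simp

lemma Cauchy_Schwarz:
  assumes "u \<in> V" "v \<in> V"
  shows "\<bar>ip u v\<bar> \<le> sqrt (ip u u) * sqrt (ip v v)"
proof -
  have quad: "0 \<le> ip u u + 2 * s * ip u v + s\<^sup>2 * ip v v" for s
    using ip_nonneg[OF lin_closed[OF assms, of 1 s]] ip_lin_self[OF assms, of 1 s] by simp
  have "(ip u v)\<^sup>2 \<le> ip u u * ip v v"
  proof (cases "ip v v = 0")
    case True
    have "ip u v = 0"
    proof (rule ccontr)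
      assume "ip u v \<noteq> 0"
      then show False using quad[of "- (ip u u + 1) / (2 * ip u v)"] True by (simp add: field_simps)
    qed
    then show ?thesis using True by simp
  next
    case False
    then have pos: "ip v v > 0" using ip_nonneg[OF assms(2)] by simp
    have "0 \<le> ip u u - (ip u v)\<^sup>2 / ip v v"
      using quad[of "- ip u v / ip v v"] pos by (simp add: field_simps power2_eq_square)
    then show ?thesis using pos by (simp add: field_simps)
  qed
  then have "sqrt ((ip u v)\<^sup>2) \<le> sqrt (ip u u * ip v v)" by (rule real_sqrt_le_mono)
  then show ?thesis by (simp add: real_sqrt_mult)
qed

lemma ip_in_dual:
  assumes "v \<in> V"
  shows "(\<lambda>u. ip u v) \<in> dual"
proof -
  have "\<exists>C. \<forall>u\<in>V. \<bar>ip u v\<bar> \<le> C * sqrt (ip u u)"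
    using Cauchy_Schwarz[OF _ assms] by (intro exI[of _ "sqrt (ip v v)"]) (simp add: mult.commute)
  then show ?thesis using assms by (auto simp: dual_def ip_add_left ip_scale_left)
qed

lemma dual_lin:
  assumes "\<phi> \<in> dual" "u \<in> V" "v \<in> V"
  shows "\<phi> (\<lambda>x. a *\<^sub>R u x + b *\<^sub>R v x) = a * \<phi> u + b * \<phi> v"
  using assms by (simp add: dual_def scale_closed)

lemma dual_diff:
  assumes "\<phi> \<in> dual" "u \<in> V" "v \<in> V"
  shows "\<phi> (\<lambda>x. u x - v x) = \<phi> u - \<phi> v"
  using dual_lin[OF assms, of 1 "-1"] by simp

lemma dual_bound:
  assumes "\<phi> \<in> dual"
  shows "\<exists>C. \<forall>u\<in>V. \<bar>\<phi> u\<bar> \<le> C * sqrt (ip u u)"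
  using assms by (simp add: dual_def)

lemma dual_tendsto:
  assumes "\<phi> \<in> dual" "\<And>n. c n \<in> V" "w \<in> V"
    and "(\<lambda>n. ip (\<lambda>x. c n x - w x) (\<lambda>x. c n x - w x)) \<longlonglongrightarrow> 0"
  shows "(\<lambda>n. \<phi> (c n)) \<longlonglongrightarrow> \<phi> w"
proof -
  obtain C where C: "\<forall>u\<in>V. \<bar>\<phi> u\<bar> \<le> C * sqrt (ip u u)"
    using dual_bound[OF assms(1)] by blast
  have "(\<lambda>n. C * sqrt (ip (\<lambda>x. c n x - w x) (\<lambda>x. c n x - w x))) \<longlonglongrightarrow> C * sqrt 0"
    by (intro tendsto_intros assms(4))
  then have lim: "(\<lambda>n. C * sqrt (ip (\<lambda>x. c n x - w x) (\<lambda>x. c n x - w x))) \<longlonglongrightarrow> 0" by simp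
  have "norm (\<phi> (c n) - \<phi> w) \<le> C * sqrt (ip (\<lambda>x. c n x - w x) (\<lambda>x. c n x - w x))" for n
    using bspec[OF C diff_closed[OF assms(2,3)]] dual_diff[OF assms(1) assms(2,3)] by simp
  then have "(\<lambda>n. \<phi> (c n) - \<phi> w) \<longlonglongrightarrow> 0"
    by (intro Lim_null_comparison[OF _ lim]) (simp add: eventually_sequentially)
  then show ?thesis by (simp add: LIM_zero_iff)
qed

lemma tail_hull_in:
  assumes "\<And>i. u i \<in> V" "c \<in> tail_hull u n"
  shows "c \<in> V"
  using assms(2) by induction (auto intro: lin_closed assms(1))

lemma dual_tail_hull_close:
  assumes "\<phi> \<in> dual" "\<And>i. u i \<in> V" "\<And>i. n \<le> i \<Longrightarrow> \<bar>\<phi> (u i) - l\<bar> \<le> e"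
    and "c \<in> tail_hull u n"
  shows "\<bar>\<phi> c - l\<bar> \<le> e"
  using assms(4)
proof induction
  case (comb a b t)
  have "\<phi> (\<lambda>x. (1 - t) *\<^sub>R a x + t *\<^sub>R b x) - l = (1 - t) * (\<phi> a - l) + t * (\<phi> b - l)"
    using comb tail_hull_in[OF assms(2)] by (subst dual_lin[OF assms(1)]) (auto simp: algebra_simps)
  moreover have "\<bar>(1 - t) * (\<phi> a - l) + t * (\<phi> b - l)\<bar> \<le> (1 - t) * e + t * e"
    using comb by (intro order_trans[OF abs_triangle_ineq] add_mono)
      (auto simp: abs_mult intro!: mult_left_mono)
  ultimately show ?case by (simp add: algebra_simps)
qed (use assms(3) in auto)

text \<open>
  The values of \<open>\<phi>\<close> on the \<open>n\<close>-th tail hull are as close to \<open>l\<close> as those on the tail itself. So a strong limit of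
  elements of the tail hulls is the only candidate for the weak limit.
\<close>

lemma dual_limit_unique:
  assumes "\<phi> \<in> dual" "\<And>i. u i \<in> V" "w \<in> V" "\<And>n. c n \<in> tail_hull u n"
    and "(\<lambda>n. ip (\<lambda>x. c n x - w x) (\<lambda>x. c n x - w x)) \<longlonglongrightarrow> 0"
    and "(\<lambda>i. \<phi> (u i)) \<longlonglongrightarrow> l"
  shows "\<phi> w = l"
proof -
  have "(\<lambda>n. \<phi> (c n)) \<longlonglongrightarrow> l"
  proof (rule LIMSEQ_I)
    fix e :: real assume "0 < e"
    then obtain N where N: "\<And>i. N \<le> i \<Longrightarrow> \<bar>\<phi> (u i) - l\<bar> < e / 2"
      using LIMSEQ_D[OF assms(6), of "e / 2"] by auto
    have "norm (\<phi> (c n) - l) < e" if "N \<le> n" for n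
    proof -
      have "\<bar>\<phi> (c n) - l\<bar> \<le> e / 2"
        by (rule dual_tail_hull_close[OF assms(1,2) _ assms(4)])
           (use N that in \<open>auto intro: less_imp_le\<close>)
      then show ?thesis using \<open>0 < e\<close> by simp
    qed
    then show "\<exists>N. \<forall>n\<ge>N. norm (\<phi> (c n) - l) < e" by blast
  qed
  moreover have "(\<lambda>n. \<phi> (c n)) \<longlonglongrightarrow> \<phi> w"
    using assms(1,3,5) tail_hull_in[OF assms(2) assms(4)] by (intro dual_tendsto) auto
  ultimately show ?thesis using LIMSEQ_unique by blast
qed

text \<open>
  The infima \<open>d n\<close> of the squared norm over the tail hulls increase to some \<open>D\<close>. If \<open>c n\<close> nearly
  attains \<open>d n\<close>, then for \<open>m, n \<ge> N\<close> the midpoint of \<open>c m\<close> and \<open>c n\<close> lies in the \<open>N\<close>-th hull, so its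
  squared norm is at least \<open>d N\<close>, and the parallelogram law bounds the squared distance of \<open>c m\<close> and
  \<open>c n\<close> by a multiple of \<open>D - d N\<close> plus the error of the near minimality.
\<close>

lemma tail_hull_strong_limit:
  assumes u: "\<And>i. u i \<in> V" and B: "\<And>i. ip (u i) (u i) \<le> B"
  obtains c w where "\<And>n. c n \<in> tail_hull u n" "w \<in> V"
    "(\<lambda>n. ip (\<lambda>x. c n x - w x) (\<lambda>x. c n x - w x)) \<longlonglongrightarrow> 0"
proof -
  define d where "d n = Inf ((\<lambda>c. ip c c) ` tail_hull u n)" for n
  have ne: "tail_hull u n \<noteq> {}" for n using tail_hull.base[of n n u] by auto
  have inV: "c \<in> V" if "c \<in> tail_hull u n" for c n using tail_hull_in[OF u that] .
  have bdd: "bdd_below ((\<lambda>c. ip c c) ` tail_hull u n)" for n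
    using ip_nonneg inV by (auto intro!: bdd_belowI[of _ 0])
  have d_le: "d n \<le> ip c c" if "c \<in> tail_hull u n" for c n
    unfolding d_def by (rule cInf_lower[OF _ bdd]) (use that in auto)
  have "\<exists>c\<in>tail_hull u n. ip c c < d n + 1 / real (Suc n)" for n
    using cInf_lessD[of "(\<lambda>c. ip c c) ` tail_hull u n" "d n + 1 / real (Suc n)"] ne
    by (auto simp: d_def)
  then obtain c where c: "\<And>n. c n \<in> tail_hull u n" "\<And>n. ip (c n) (c n) < d n + 1 / real (Suc n)"
    by metis
  have "incseq d"
    unfolding d_def incseq_def
    by (intro allI impI cInf_superset_mono bdd image_mono tail_hull_antimono) (use ne in auto)
  have "d n \<le> B" for n
    using d_le[OF tail_hull.base[of n n u]] B[of n] by simp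
  with \<open>incseq d\<close> obtain D where D: "d \<longlonglongrightarrow> D" "\<And>n. d n \<le> D"
    using incseq_convergent[of d B] by auto
  have cauchy: "ip (\<lambda>x. c m x - c n x) (\<lambda>x. c m x - c n x) \<le> 4 * (D - d N) + 4 * (1 / real (Suc N))"
    if "N \<le> m" "N \<le> n" for m n N
  proof -
    have cN: "c m \<in> tail_hull u N" "c n \<in> tail_hull u N"
      using c(1) tail_hull_antimono that by blast+
    have V: "c m \<in> V" "c n \<in> V" using cN inV by auto
    have "d N \<le> ip (\<lambda>x. (1 - 1/2) *\<^sub>R c m x + (1/2) *\<^sub>R c n x) (\<lambda>x. (1 - 1/2) *\<^sub>R c m x + (1/2) *\<^sub>R c n x)"
      by (intro d_le tail_hull.comb cN) auto
    also have "\<dots> = (ip (c m) (c m) + 2 * ip (c m) (c n) + ip (c n) (c n)) / 4"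
      using ip_lin_self[OF V, of "1 - 1/2" "1/2"] by (simp add: power2_eq_square field_simps)
    finally have par: "ip (\<lambda>x. c m x - c n x) (\<lambda>x. c m x - c n x)
        \<le> 2 * ip (c m) (c m) + 2 * ip (c n) (c n) - 4 * d N"
      using ip_diff_self[OF V] by simp
    have near: "ip (c k) (c k) \<le> D + 1 / real (Suc N)" if "N \<le> k" for k
    proof -
      have "1 / real (Suc k) \<le> 1 / real (Suc N)" using that by (intro divide_left_mono) auto
      then show ?thesis using c(2)[of k] D(2)[of k] by linarith
    qed
    show ?thesis using par near[OF that(1)] near[OF that(2)] by argo
  qed
  have "(\<lambda>N. 4 * (D - d N) + 4 * (1 / real (Suc N))) \<longlonglongrightarrow> 4 * (D - D) + 4 * 0"
    by (intro tendsto_intros D(1) LIMSEQ_Suc[OF lim_1_over_n])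
  then have small: "(\<lambda>N. 4 * (D - d N) + 4 * (1 / real (Suc N))) \<longlonglongrightarrow> 0" by simp
  have "\<exists>v\<in>V. (\<lambda>n. ip (\<lambda>x. c n x - v x) (\<lambda>x. c n x - v x)) \<longlonglongrightarrow> 0"
  proof (rule complete)
    show "c n \<in> V" for n using c(1) inV by blast
    fix e :: real assume "0 < e"
    then have "eventually (\<lambda>N. 4 * (D - d N) + 4 * (1 / real (Suc N)) < e) sequentially"
      using order_tendstoD(2)[OF small] by blast
    then obtain N where "4 * (D - d N) + 4 * (1 / real (Suc N)) < e"
      by (auto simp: eventually_sequentially)
    then show "\<exists>N. \<forall>m\<ge>N. \<forall>n\<ge>N. ip (\<lambda>x. c m x - c n x) (\<lambda>x. c m x - c n x) < e"
      using cauchy by (meson le_less_trans)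
  qed
  then show ?thesis using c(1) that by blast
qed

lemma gram_convergent_subseq:
  assumes u: "\<And>i. u i \<in> V" and B: "\<And>i. ip (u i) (u i) \<le> B"
  obtains r where "strict_mono (r :: nat \<Rightarrow> nat)" "\<And>j. convergent (\<lambda>i. ip (u (r i)) (u j))"
proof -
  have bound: "\<bar>ip (u i) (u j)\<bar> \<le> B" for i j
  proof -
    have "sqrt (ip (u i) (u i)) * sqrt (ip (u j) (u j)) \<le> sqrt B * sqrt B"
      by (intro mult_mono real_sqrt_le_mono B) (auto intro: ip_nonneg u order_trans[OF _ B])
    then show ?thesis using Cauchy_Schwarz[OF u u, of i j] order_trans[OF ip_nonneg[OF u] B] by simp
  qed
  interpret subseqs "\<lambda>j s. convergent (\<lambda>i. ip (u (s i)) (u j))"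
  proof
    fix j and s :: "nat \<Rightarrow> nat"
    obtain r' l where "strict_mono (r' :: nat \<Rightarrow> nat)" "(\<lambda>i. ip (u (s (r' i))) (u j)) \<longlonglongrightarrow> l"
      using bounded_real_convergent_subseq[of "\<lambda>i. ip (u (s i)) (u j)", OF bound] by blast
    then show "\<exists>r'. strict_mono r' \<and> convergent (\<lambda>i. ip (u ((s \<circ> r') i)) (u j))"
      by (auto simp: convergent_def)
  qed
  have "convergent (\<lambda>i. ip (u (diagseq i)) (u j))" for j
  proof -
    have "convergent (\<lambda>i. ip (u ((diagseq \<circ> (+) (Suc j)) i)) (u j))"
    proof (rule diagseq_holds)
      fix r s :: "nat \<Rightarrow> nat" and n
      assume "strict_mono r" "convergent (\<lambda>i. ip (u (s i)) (u n))"
      then show "convergent (\<lambda>i. ip (u ((s \<circ> r) i)) (u n))"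
        using convergent_subseq_convergent[of "\<lambda>i. ip (u (s i)) (u n)" r] by (simp add: o_def)
    qed
    then show ?thesis
      using convergent_ignore_initial_segment[of "\<lambda>i. ip (u (diagseq i)) (u j)" "Suc j"]
      by (simp add: o_def add.commute)
  qed
  then show ?thesis using that subseq_diagseq by blast
qed

text \<open>
  Both \<open>w\<close> and \<open>w'\<close> lie in the closed span of the \<open>u i\<close>, and their difference is
  orthogonal to every \<open>u i\<close>, hence to itself. In a semi-inner product space this makes only the
  values of bounded functionals agree.
\<close>

lemma gram_determines_limit:
  assumes u: "\<And>i. u i \<in> V" and \<phi>: "\<phi> \<in> dual"
    and gram: "\<And>j. ip w (u j) = ip w' (u j)"
    and w: "w \<in> V" "\<And>n. c n \<in> tail_hull u n"
      "(\<lambda>n. ip (\<lambda>x. c n x - w x) (\<lambda>x. c n x - w x)) \<longlonglongrightarrow> 0"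
    and w': "w' \<in> V" "\<And>n. c' n \<in> tail_hull u n"
      "(\<lambda>n. ip (\<lambda>x. c' n x - w' x) (\<lambda>x. c' n x - w' x)) \<longlonglongrightarrow> 0"
  shows "\<phi> w = \<phi> w'"
proof -
  define d where "d = (\<lambda>x. w x - w' x)"
  have d: "d \<in> V" unfolding d_def by (intro diff_closed w w')
  have ip_d: "ip v d = ip v w - ip v w'" if "v \<in> V" for v
    using dual_diff[OF ip_in_dual[OF that] w(1) w'(1)] ip_commute[OF that d]
      ip_commute[OF that w(1)] ip_commute[OF that w'(1)] by (simp add: d_def)
  have orth: "ip a d = 0" if "a \<in> tail_hull u n" for a n
    using that
  proof induction
    case (base i)
    then show ?case using ip_d[OF u] gram[of i] ip_commute[OF u w(1)] ip_commute[OF u w'(1)] by simp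
  next
    case (comb a b t)
    then show ?case using tail_hull_in[OF u] by (subst ip_lin_left) (auto intro: d)
  qed
  have zero: "ip v d = 0"
    if v: "v \<in> V" "\<And>n. a n \<in> tail_hull u n"
      "(\<lambda>n. ip (\<lambda>x. a n x - v x) (\<lambda>x. a n x - v x)) \<longlonglongrightarrow> 0" for v a
  proof -
    have "(\<lambda>n. ip (a n) d) \<longlonglongrightarrow> ip v d"
      using tail_hull_in[OF u v(2)] v by (intro dual_tendsto[OF ip_in_dual[OF d]]) auto
    then have "(\<lambda>n. 0) \<longlonglongrightarrow> ip v d" using orth[OF v(2)] by simp
    then show ?thesis using LIMSEQ_unique tendsto_const by blast
  qed
  have "ip d d = 0"
    using zero[OF w] zero[OF w'] dual_diff[OF ip_in_dual[OF d] w(1) w'(1)] by (simp add: d_def)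
  obtain C where "\<forall>u\<in>V. \<bar>\<phi> u\<bar> \<le> C * sqrt (ip u u)"
    using dual_bound[OF \<phi>] by blast
  with d \<open>ip d d = 0\<close> have "\<phi> d = 0" by force
  then show ?thesis using dual_diff[OF \<phi> w(1) w'(1)] by (simp add: d_def)
qed

text \<open>
  If \<open>\<phi>\<close> did not converge to \<open>\<phi> w\<close> along the diagonal subsequence, it would converge to another value
  along a further one. The strong limit \<open>w'\<close> belonging to that one has the same inner products with
  all \<open>u j\<close> as \<open>w\<close>, which contradicts \<open>\<phi> w \<noteq> \<phi> w'\<close>.

  The sequence \<open>c\<close> is part of the conclusion because lower semicontinuity of convex functionals is
  read off from it.
\<close>

theorem bounded_weakly_convergent_subseq:
  assumes u: "\<And>i. u i \<in> V" and B: "\<And>i. ip (u i) (u i) \<le> B"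
  obtains r c w where "strict_mono (r :: nat \<Rightarrow> nat)" "w \<in> V"
    "\<And>n. c n \<in> tail_hull u n"
    "(\<lambda>n. ip (\<lambda>x. c n x - w x) (\<lambda>x. c n x - w x)) \<longlonglongrightarrow> 0"
    "\<And>\<phi>. \<phi> \<in> dual \<Longrightarrow> (\<lambda>i. \<phi> (u (r i))) \<longlonglongrightarrow> \<phi> w"
proof -
  obtain r where r: "strict_mono (r :: nat \<Rightarrow> nat)" "\<And>j. convergent (\<lambda>i. ip (u (r i)) (u j))"
    by (rule gram_convergent_subseq[of u B]) (use u B in auto)
  define v where "v = (\<lambda>i. u (r i))"
  have v: "v i \<in> V" "ip (v i) (v i) \<le> B" for i by (simp_all add: v_def u B)
  obtain c w where c: "\<And>n. c n \<in> tail_hull v n" and w: "w \<in> V"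
    and lim: "(\<lambda>n. ip (\<lambda>x. c n x - w x) (\<lambda>x. c n x - w x)) \<longlonglongrightarrow> 0"
    by (rule tail_hull_strong_limit[of v B]) (use v in auto)
  have cu: "c n \<in> tail_hull u n" for n
    using c[of n] tail_hull_subseq[OF r(1), of u n] by (auto simp: v_def)
  have weak: "(\<lambda>i. \<phi> (v i)) \<longlonglongrightarrow> \<phi> w" if \<phi>: "\<phi> \<in> dual" for \<phi>
  proof (rule ccontr)
    assume "\<not> ?thesis"
    then obtain e where e: "0 < e" "\<And>N. \<exists>i\<ge>N. e \<le> \<bar>\<phi> (v i) - \<phi> w\<bar>"
      unfolding LIMSEQ_def dist_real_def by (metis not_le)
    then have "infinite {i. e \<le> \<bar>\<phi> (v i) - \<phi> w\<bar>}"
      unfolding infinite_nat_iff_unbounded_le by auto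
    then obtain s :: "nat \<Rightarrow> nat" where s: "strict_mono s" "\<And>i. e \<le> \<bar>\<phi> (v (s i)) - \<phi> w\<bar>"
      using infinite_enumerate by blast
    obtain C where C: "\<forall>u\<in>V. \<bar>\<phi> u\<bar> \<le> C * sqrt (ip u u)"
      using dual_bound[OF \<phi>] by blast
    have "\<bar>\<phi> (v (s i))\<bar> \<le> \<bar>C\<bar> * sqrt B" for i
    proof -
      have "C * sqrt (ip (v (s i)) (v (s i))) \<le> \<bar>C\<bar> * sqrt B"
        by (intro mult_mono real_sqrt_le_mono v) (auto intro: ip_nonneg v)
      then show ?thesis using bspec[OF C v(1), of "s i"] by linarith
    qed
    then obtain l s' where s': "strict_mono (s' :: nat \<Rightarrow> nat)" "(\<lambda>i. \<phi> (v (s (s' i)))) \<longlonglongrightarrow> l"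
      using bounded_real_convergent_subseq[of "\<lambda>i. \<phi> (v (s i))"] by blast
    define q where "q = s \<circ> s'"
    have q: "strict_mono q" using s(1) s'(1) by (simp add: q_def strict_mono_o)
    define v' where "v' = (\<lambda>i. v (q i))"
    have v': "v' i \<in> V" "ip (v' i) (v' i) \<le> B" for i by (simp_all add: v'_def v)
    obtain c' w' where c': "\<And>n. c' n \<in> tail_hull v' n" and w': "w' \<in> V"
      and lim': "(\<lambda>n. ip (\<lambda>x. c' n x - w' x) (\<lambda>x. c' n x - w' x)) \<longlonglongrightarrow> 0"
      by (rule tail_hull_strong_limit[of v' B]) (use v' in auto)
    have "\<phi> w' = l"
      by (rule dual_limit_unique[OF \<phi> v'(1) w' c' lim']) (use s' in \<open>simp add: v'_def q_def\<close>)
    have "ip w (u j) = ip w' (u j)" for j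
    proof -
      obtain L where L: "(\<lambda>i. ip (v i) (u j)) \<longlonglongrightarrow> L"
        using r(2)[of j] by (auto simp: convergent_def v_def)
      have "ip w (u j) = L"
        by (rule dual_limit_unique[OF ip_in_dual[OF u] v(1) w c lim L])
      moreover have "ip w' (u j) = L"
        by (rule dual_limit_unique[OF ip_in_dual[OF u] v'(1) w' c' lim'])
           (use LIMSEQ_subseq_LIMSEQ[OF L q] in \<open>simp add: v'_def o_def\<close>)
      ultimately show ?thesis by simp
    qed
    moreover have "c' n \<in> tail_hull u n" for n
      using c'[of n] tail_hull_subseq[OF q, of v n] tail_hull_subseq[OF r(1), of u n]
      by (auto simp: v'_def v_def)
    ultimately have "\<phi> w = \<phi> w'"
      by (intro gram_determines_limit[OF u \<phi> _ w cu lim w' _ lim'])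
    then have "(\<lambda>i. \<phi> (v (s (s' i)))) \<longlonglongrightarrow> \<phi> w" using s'(2) \<open>\<phi> w' = l\<close> by simp
    then obtain i where "\<bar>\<phi> (v (s (s' i))) - \<phi> w\<bar> < e"
      using LIMSEQ_D[of _ "\<phi> w" e] e(1) by fastforce
    then show False using s(2)[of "s' i"] by simp
  qed
  show ?thesis
    by (rule that[OF r(1) w cu lim]) (use weak in \<open>simp add: v_def\<close>)
qed

end

section \<open>Completeness of the square-integrable functions\<close>

lemma integrable_norm_sq_lin:
  fixes u v :: "'a \<Rightarrow> 'b::euclidean_space"
  assumes [measurable]: "u \<in> borel_measurable M" "v \<in> borel_measurable M"
    and "integrable M (\<lambda>x. (norm (u x))\<^sup>2)" "integrable M (\<lambda>x. (norm (v x))\<^sup>2)"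
  shows "integrable M (\<lambda>x. (norm (a *\<^sub>R u x + b *\<^sub>R v x))\<^sup>2)"
proof (rule Bochner_Integration.integrable_bound)
  show "integrable M (\<lambda>x. 2 * a\<^sup>2 * (norm (u x))\<^sup>2 + 2 * b\<^sup>2 * (norm (v x))\<^sup>2)"
    by (intro Bochner_Integration.integrable_add integrable_mult_right assms)
  have "(norm (a *\<^sub>R u x + b *\<^sub>R v x))\<^sup>2 \<le> 2 * a\<^sup>2 * (norm (u x))\<^sup>2 + 2 * b\<^sup>2 * (norm (v x))\<^sup>2" for x
  proof -
    have "(norm (a *\<^sub>R u x + b *\<^sub>R v x))\<^sup>2 \<le> (norm (a *\<^sub>R u x) + norm (b *\<^sub>R v x))\<^sup>2"
      by (intro power_mono norm_triangle_ineq) auto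
    also have "\<dots> \<le> 2 * (norm (a *\<^sub>R u x))\<^sup>2 + 2 * (norm (b *\<^sub>R v x))\<^sup>2"
      using sum_squares_bound[of "norm (a *\<^sub>R u x)" "norm (b *\<^sub>R v x)"]
      by (simp add: power2_sum)
    finally show ?thesis by (simp add: power_mult_distrib)
  qed
  then show "AE x in M. norm ((norm (a *\<^sub>R u x + b *\<^sub>R v x))\<^sup>2)
      \<le> norm (2 * a\<^sup>2 * (norm (u x))\<^sup>2 + 2 * b\<^sup>2 * (norm (v x))\<^sup>2)"
    by auto
qed auto

lemma integrable_norm_sq_diff:
  fixes u v :: "'a \<Rightarrow> 'b::euclidean_space"
  assumes "u \<in> borel_measurable M" "v \<in> borel_measurable M"
    and "integrable M (\<lambda>x. (norm (u x))\<^sup>2)" "integrable M (\<lambda>x. (norm (v x))\<^sup>2)"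
  shows "integrable M (\<lambda>x. (norm (u x - v x))\<^sup>2)"
  using integrable_norm_sq_lin[OF assms, of 1 "-1"] by simp

lemma integrable_inner_sq:
  fixes u v :: "'a \<Rightarrow> 'b::euclidean_space"
  assumes [measurable]: "u \<in> borel_measurable M" "v \<in> borel_measurable M"
    and "integrable M (\<lambda>x. (norm (u x))\<^sup>2)" "integrable M (\<lambda>x. (norm (v x))\<^sup>2)"
  shows "integrable M (\<lambda>x. u x \<bullet> v x)"
proof -
  have "(\<lambda>x. u x \<bullet> v x) = (\<lambda>x. ((norm (u x))\<^sup>2 + (norm (v x))\<^sup>2 - (norm (u x - v x))\<^sup>2) / 2)"
    by (rule ext) (simp add: power2_norm_eq_inner inner_diff inner_commute)
  then show ?thesis
    using integrable_norm_sq_diff[OF assms] assms by simp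
qed

text \<open>
  The series of the norms of the increments has a finite integral, so it converges almost
  everywhere. On a space of finite measure the passage from squares to first powers needs
  only \<open>a \<le> 2^n * a\<^sup>2 + (1/2)^n\<close>, where the weights are chosen such that both terms
  integrate to a multiple of \<open>(1/2)^n\<close>.
\<close>

lemma (in finite_measure) norm_sq_summable_increments_imp_AE_convergent:
  fixes w :: "nat \<Rightarrow> 'a \<Rightarrow> 'b::euclidean_space"
  assumes [measurable]: "\<And>n. w n \<in> borel_measurable M"
    and int: "\<And>n. integrable M (\<lambda>x. (norm (w (Suc n) x - w n x))\<^sup>2)"
    and small: "\<And>n. (LINT x|M. (norm (w (Suc n) x - w n x))\<^sup>2) \<le> (1/4) ^ n"
  shows "AE x in M. convergent (\<lambda>n. w n x)"
proof -
  define D where "D n x = norm (w (Suc n) x - w n x)" for n x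
  have [measurable]: "D n \<in> borel_measurable M" for n unfolding D_def by measurable
  have step: "(\<integral>\<^sup>+ x. ennreal (D n x) \<partial>M) \<le> ennreal ((1/2) ^ n * (1 + measure M (space M)))" for n
  proof -
    have intD: "integrable M (\<lambda>x. 2 ^ n * (D n x)\<^sup>2 + (1/2) ^ n)"
      using int[of n] by (auto simp: D_def)
    have "D n x \<le> 2 ^ n * (D n x)\<^sup>2 + (1/2) ^ n" for x
    proof -
      have "0 \<le> (2 ^ n * D n x - 1)\<^sup>2 + 2 ^ n * D n x" by (auto simp: D_def)
      then have "2 ^ n * D n x \<le> 2 ^ n * (2 ^ n * (D n x)\<^sup>2 + (1/2) ^ n)"
        by (simp add: power2_diff power_mult_distrib algebra_simps power_one_over power2_eq_square)
      then show ?thesis by simp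
    qed
    then have "(\<integral>\<^sup>+ x. ennreal (D n x) \<partial>M) \<le> (\<integral>\<^sup>+ x. ennreal (2 ^ n * (D n x)\<^sup>2 + (1/2) ^ n) \<partial>M)"
      by (intro nn_integral_mono ennreal_leI)
    also have "\<dots> = ennreal (LINT x|M. 2 ^ n * (D n x)\<^sup>2 + (1/2) ^ n)"
      by (rule nn_integral_eq_integral[OF intD]) auto
    also have "(LINT x|M. 2 ^ n * (D n x)\<^sup>2 + (1/2) ^ n)
        = 2 ^ n * (LINT x|M. (D n x)\<^sup>2) + (1/2) ^ n * measure M (space M)"
      using int[of n] by (subst Bochner_Integration.integral_add) (auto simp: D_def)
    also have "\<dots> \<le> 2 ^ n * (1/4) ^ n + (1/2) ^ n * measure M (space M)"
      using small[of n] by (auto simp: D_def)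
    also have "(2::real) ^ n * (1/4) ^ n = (1/2) ^ n"
      by (simp flip: power_mult_distrib)
    finally show ?thesis by (simp add: algebra_simps ennreal_leI)
  qed
  have "(\<integral>\<^sup>+ x. (\<Sum>n. ennreal (D n x)) \<partial>M) = (\<Sum>n. \<integral>\<^sup>+ x. ennreal (D n x) \<partial>M)"
    by (rule nn_integral_suminf) measurable
  also have "\<dots> \<le> (\<Sum>n. ennreal ((1/2) ^ n * (1 + measure M (space M))))"
    by (intro suminf_le step) auto
  also have "\<dots> = ennreal (\<Sum>n. (1/2) ^ n * (1 + measure M (space M)))"
    by (intro suminf_ennreal2) (auto intro!: summable_mult2 summable_geometric)
  also have "\<dots> < \<infinity>" by simp
  finally have "AE x in M. (\<Sum>n. ennreal (D n x)) \<noteq> \<infinity>"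
    by (intro nn_integral_PInf_AE) auto
  then show ?thesis
  proof eventually_elim
    case (elim x)
    have "summable (\<lambda>n. D n x)"
      by (rule summable_suminf_not_top) (use elim in \<open>auto simp: D_def\<close>)
    then have "summable (\<lambda>n. w (Suc n) x - w n x)"
      unfolding D_def by (rule summable_norm_cancel)
    then have "convergent (\<lambda>n. (\<Sum>i<n. w (Suc i) x - w i x) + w 0 x)"
      by (auto simp: summable_iff_convergent intro: convergent_add convergent_const)
    then show ?case using sum_lessThan_telescope[of "\<lambda>n. w n x"] by simp
  qed
qed

text \<open>
  A rapidly Cauchy subsequence converges almost everywhere to some \<open>v\<close>. Fatou's lemma applied to
  the squared distances from \<open>w m\<close> shows that \<open>v\<close> is also the limit in the mean square.
\<close>

theorem (in finite_measure) norm_sq_Cauchy_convergent: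
  fixes w :: "nat \<Rightarrow> 'a \<Rightarrow> 'b::euclidean_space"
  assumes [measurable]: "\<And>n. w n \<in> borel_measurable M"
    and int: "\<And>n. integrable M (\<lambda>x. (norm (w n x))\<^sup>2)"
    and cauchy: "\<And>e. 0 < e \<Longrightarrow> \<exists>N. \<forall>m\<ge>N. \<forall>n\<ge>N. (LINT x|M. (norm (w m x - w n x))\<^sup>2) < e"
  obtains v where "v \<in> borel_measurable M" "integrable M (\<lambda>x. (norm (v x))\<^sup>2)"
    "(\<lambda>n. LINT x|M. (norm (w n x - v x))\<^sup>2) \<longlonglongrightarrow> 0"
proof -
  have int_diff: "integrable M (\<lambda>x. (norm (w m x - w n x))\<^sup>2)" for m n
    by (intro integrable_norm_sq_diff int assms(1))
  have "\<forall>k. \<exists>N. \<forall>m\<ge>N. \<forall>n\<ge>N. (LINT x|M. (norm (w m x - w n x))\<^sup>2) < (1/4) ^ k"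
    by (intro allI cauchy) auto
  then obtain N where N: "\<And>k m n. N k \<le> m \<Longrightarrow> N k \<le> n \<Longrightarrow>
      (LINT x|M. (norm (w m x - w n x))\<^sup>2) < (1/4) ^ k"
    by metis
  \<comment> \<open>The sum puts both \<open>r k\<close> and \<open>r (Suc k)\<close> above \<open>N k\<close>; the summand \<open>k\<close> makes \<open>r\<close> tend to
     infinity.\<close>
  define r where "r k = k + (\<Sum>i\<le>k. N i)" for k
  have "N k \<le> r k" for k unfolding r_def using member_le_sum[of k "{..k}" N] by simp
  moreover have "N k \<le> r (Suc k)" for k unfolding r_def using member_le_sum[of k "{..Suc k}" N] by simp
  ultimately have conv: "AE x in M. convergent (\<lambda>k. w (r k) x)"
    by (intro norm_sq_summable_increments_imp_AE_convergent int_diff less_imp_le[OF N]) auto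
  define v where "v x = lim (\<lambda>k. w (r k) x)" for x
  have [measurable]: "v \<in> borel_measurable M" unfolding v_def by measurable
  have lim: "AE x in M. (\<lambda>k. w (r k) x) \<longlonglongrightarrow> v x"
    using conv by eventually_elim (simp add: v_def convergent_LIMSEQ_iff)
  have fatou: "(\<integral>\<^sup>+ x. ennreal ((norm (w m x - v x))\<^sup>2) \<partial>M) \<le> ennreal e"
    if e: "0 < e" and K: "\<And>n. K \<le> n \<Longrightarrow> (LINT x|M. (norm (w m x - w n x))\<^sup>2) < e" for m K e
  proof -
    have "(\<integral>\<^sup>+ x. ennreal ((norm (w m x - v x))\<^sup>2) \<partial>M)
        = (\<integral>\<^sup>+ x. liminf (\<lambda>k. ennreal ((norm (w m x - w (r k) x))\<^sup>2)) \<partial>M)"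
    proof (rule nn_integral_cong_AE, use lim in eventually_elim)
      case (elim x)
      then have "(\<lambda>k. ennreal ((norm (w m x - w (r k) x))\<^sup>2)) \<longlonglongrightarrow> ennreal ((norm (w m x - v x))\<^sup>2)"
        by (intro tendsto_intros)
      then show ?case by (rule lim_imp_Liminf[OF trivial_limit_sequentially, symmetric])
    qed
    also have "\<dots> \<le> liminf (\<lambda>k. \<integral>\<^sup>+ x. ennreal ((norm (w m x - w (r k) x))\<^sup>2) \<partial>M)"
      by (rule nn_integral_liminf) measurable
    also have "\<dots> = liminf (\<lambda>k. ennreal (LINT x|M. (norm (w m x - w (r k) x))\<^sup>2))"
      by (simp add: nn_integral_eq_integral[OF int_diff])
    also have "\<dots> \<le> liminf (\<lambda>k. ennreal e)"
    proof (rule Liminf_mono, unfold eventually_sequentially, intro exI allI impI)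
      fix k assume "K \<le> k"
      then have "K \<le> r k" by (simp add: r_def)
      then show "ennreal (LINT x|M. (norm (w m x - w (r k) x))\<^sup>2) \<le> ennreal e"
        by (rule ennreal_leI[OF less_imp_le[OF K]])
    qed
    finally show ?thesis by (simp add: Liminf_const)
  qed
  have int_lim: "integrable M (\<lambda>x. (norm (w m x - v x))\<^sup>2)"
    and le_lim: "(LINT x|M. (norm (w m x - v x))\<^sup>2) \<le> e"
    if "0 < e" "\<And>n. K \<le> n \<Longrightarrow> (LINT x|M. (norm (w m x - w n x))\<^sup>2) < e" for m K e
  proof -
    note le = fatou[OF that]
    show int: "integrable M (\<lambda>x. (norm (w m x - v x))\<^sup>2)"
      by (rule integrableI_bounded) (use le_less_trans[OF le ennreal_less_top] in auto)
    have "ennreal (LINT x|M. (norm (w m x - v x))\<^sup>2) \<le> ennreal e"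
      using le by (simp add: nn_integral_eq_integral[OF int])
    then show "(LINT x|M. (norm (w m x - v x))\<^sup>2) \<le> e" using that(1) by simp
  qed
  obtain K where K: "\<And>m n. K \<le> m \<Longrightarrow> K \<le> n \<Longrightarrow> (LINT x|M. (norm (w m x - w n x))\<^sup>2) < 1"
    using cauchy[of 1] by auto
  \<comment> \<open>\<open>v\<close> is square integrable as the difference of \<open>w K\<close> and \<open>w K - v\<close>.\<close>
  have "integrable M (\<lambda>x. (norm (w K x - v x))\<^sup>2)"
    by (rule int_lim[of 1 K]) (use K in auto)
  then have "integrable M (\<lambda>x. (norm (w K x - (w K x - v x)))\<^sup>2)"
    by (rule integrable_norm_sq_diff[OF _ _ int, rotated 2]) auto
  then have "integrable M (\<lambda>x. (norm (v x))\<^sup>2)" by simp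
  moreover have "(\<lambda>n. LINT x|M. (norm (w n x - v x))\<^sup>2) \<longlonglongrightarrow> 0"
  proof (rule LIMSEQ_I)
    fix e :: real assume "0 < e"
    then obtain K where "\<And>m n. K \<le> m \<Longrightarrow> K \<le> n \<Longrightarrow> (LINT x|M. (norm (w m x - w n x))\<^sup>2) < e / 2"
      using cauchy[of "e / 2"] by auto
    then have "(LINT x|M. (norm (w m x - v x))\<^sup>2) \<le> e / 2" if "K \<le> m" for m
      using \<open>0 < e\<close> that by (intro le_lim[of "e / 2" K]) auto
    then show "\<exists>N. \<forall>n\<ge>N. norm ((LINT x|M. (norm (w n x - v x))\<^sup>2) - 0) < e"
      using \<open>0 < e\<close> by (intro exI[of _ K]) fastforce
  qed
  ultimately show ?thesis using that \<open>v \<in> borel_measurable M\<close> by blast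
qed

section \<open>Weak sequential compactness of the space L2\<close>

lemma L2_complete_semi_inner:
  fixes \<Omega> :: "'a::euclidean_space set"
  assumes "\<Omega> \<in> lmeasurable"
  shows "complete_semi_inner (L2 \<Omega> :: ('a \<Rightarrow> 'b::euclidean_space) set)
    (\<lambda>u v. LINT x|lebesgue_on \<Omega>. u x \<bullet> v x)"
proof -
  interpret finite_measure "lebesgue_on \<Omega>"
    using assms by (rule finite_measure_lebesgue_on)
  show ?thesis
  proof
    fix u v :: "'a \<Rightarrow> 'b" assume uv: "u \<in> L2 \<Omega>" "v \<in> L2 \<Omega>"
    show "(\<lambda>x. u x + v x) \<in> L2 \<Omega>"
      using uv integrable_norm_sq_lin[of u "lebesgue_on \<Omega>" v 1 1] by (auto simp: L2_def)
  next
    fix u :: "'a \<Rightarrow> 'b" and c :: real assume "u \<in> L2 \<Omega>"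
    then show "(\<lambda>x. c *\<^sub>R u x) \<in> L2 \<Omega>" by (auto simp: L2_def power_mult_distrib)
  next
    fix u v w :: "'a \<Rightarrow> 'b" assume "u \<in> L2 \<Omega>" "v \<in> L2 \<Omega>" "w \<in> L2 \<Omega>"
    then show "(LINT x|lebesgue_on \<Omega>. (u x + v x) \<bullet> w x) =
        (LINT x|lebesgue_on \<Omega>. u x \<bullet> w x) + (LINT x|lebesgue_on \<Omega>. v x \<bullet> w x)"
      by (simp add: L2_def inner_add_left integrable_inner_sq)
  next
    fix w :: "nat \<Rightarrow> 'a \<Rightarrow> 'b"
    assume w: "\<And>n. w n \<in> L2 \<Omega>" and cauchy: "\<And>e. 0 < e \<Longrightarrow> \<exists>N. \<forall>m\<ge>N. \<forall>n\<ge>N.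
      (LINT x|lebesgue_on \<Omega>. (w m x - w n x) \<bullet> (w m x - w n x)) < e"
    obtain v where "v \<in> borel_measurable (lebesgue_on \<Omega>)"
      "integrable (lebesgue_on \<Omega>) (\<lambda>x. (norm (v x))\<^sup>2)"
      "(\<lambda>n. LINT x|lebesgue_on \<Omega>. (norm (w n x - v x))\<^sup>2) \<longlonglongrightarrow> 0"
      by (rule norm_sq_Cauchy_convergent[of w])
        (use w cauchy in \<open>auto simp: L2_def power2_norm_eq_inner\<close>)
    then show "\<exists>v\<in>L2 \<Omega>. (\<lambda>n. LINT x|lebesgue_on \<Omega>. (w n x - v x) \<bullet> (w n x - v x)) \<longlonglongrightarrow> 0"
      by (intro bexI[of _ v]) (auto simp: L2_def power2_norm_eq_inner)
  qed (auto simp: inner_commute)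
qed

lemma L2_bounded_weakly_convergent_subseq:
  fixes u :: "nat \<Rightarrow> 'a::euclidean_space \<Rightarrow> 'b::euclidean_space"
  assumes \<Omega>: "\<Omega> \<in> lmeasurable" and u: "\<And>i. u i \<in> L2 \<Omega>"
    and B: "\<And>i. (LINT x|lebesgue_on \<Omega>. (norm (u i x))\<^sup>2) \<le> B"
  obtains r c w where "strict_mono (r :: nat \<Rightarrow> nat)" "L2_weak_tendsto \<Omega> (\<lambda>i. u (r i)) w"
    "\<And>n. c n \<in> L2 \<Omega>" "\<And>n. c n \<in> tail_hull u n"
    "(\<lambda>n. LINT x|lebesgue_on \<Omega>. (norm (c n x - w x))\<^sup>2) \<longlonglongrightarrow> 0"
proof -
  interpret complete_semi_inner "L2 \<Omega> :: ('a \<Rightarrow> 'b) set"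
    "\<lambda>u v. LINT x|lebesgue_on \<Omega>. u x \<bullet> v x"
    by (rule L2_complete_semi_inner[OF \<Omega>])
  have dual: "L2_dual \<Omega> = dual"
    by (simp add: L2_dual_def dual_def L2_norm_def power2_norm_eq_inner)
  obtain r c w where "strict_mono (r :: nat \<Rightarrow> nat)" and w: "w \<in> L2 \<Omega>"
    and c: "\<And>n. c n \<in> tail_hull u n"
    and lim: "(\<lambda>n. LINT x|lebesgue_on \<Omega>. (c n x - w x) \<bullet> (c n x - w x)) \<longlonglongrightarrow> 0"
    and weak: "\<And>\<phi>. \<phi> \<in> dual \<Longrightarrow> (\<lambda>i. \<phi> (u (r i))) \<longlonglongrightarrow> \<phi> w"
    by (rule bounded_weakly_convergent_subseq[of u B])
      (use u B in \<open>auto simp: power2_norm_eq_inner\<close>)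
  moreover have "L2_weak_tendsto \<Omega> (\<lambda>i. u (r i)) w"
    using u w weak by (simp add: L2_weak_tendsto_def dual)
  moreover have "c n \<in> L2 \<Omega>" for n
    using tail_hull_in[OF u c] .
  ultimately show ?thesis
    by (intro that[of r w c]) (auto simp: power2_norm_eq_inner)
qed

section \<open>Convex lower semicontinuous integrands\<close>

text \<open>
  The limit inferior in \<^const>\<open>lsc_fun\<close> is over punctured neighbourhoods; sequences that take the value
  \<open>x\<close> are covered because the bound \<open>y < g x\<close> holds at \<open>x\<close> as well.
\<close>

lemma lsc_fun_le_liminf:
  fixes g :: "'b::metric_space \<Rightarrow> ereal"
  assumes "lsc_fun g" "X \<longlonglongrightarrow> x"
  shows "g x \<le> liminf (\<lambda>n. g (X n))"
  unfolding le_Liminf_iff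
proof (intro allI impI)
  fix y assume y: "y < g x"
  have "g x \<le> Liminf (at x) g" using assms(1) by (simp add: lsc_fun_def)
  then have "eventually (\<lambda>z. y < g z) (at x)" using y unfolding le_Liminf_iff by blast
  then have "eventually (\<lambda>z. y < g z) (nhds x)"
    using y by (simp add: eventually_nhds_conv_at)
  then show "eventually (\<lambda>n. y < g (X n)) sequentially"
    using assms(2) by (rule eventually_compose_filterlim)
qed

lemma lsc_fun_borel_measurable:
  fixes g :: "'b::metric_space \<Rightarrow> ereal"
  assumes "lsc_fun g"
  shows "g \<in> borel_measurable borel"
proof (rule borel_measurableI_le)
  fix a
  have "closed {x. g x \<le> a}"
    unfolding closed_sequential_limits
  proof (intro allI impI, elim conjE)
    fix X x assume X: "\<forall>n. X n \<in> {x. g x \<le> a}" "X \<longlonglongrightarrow> x"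
    have "g x \<le> liminf (\<lambda>n. g (X n))" by (rule lsc_fun_le_liminf[OF assms X(2)])
    also have "\<dots> \<le> liminf (\<lambda>n. a)" using X(1) by (intro Liminf_mono) auto
    finally show "x \<in> {x. g x \<le> a}" by (simp add: Liminf_const)
  qed
  then show "{x \<in> space borel. g x \<le> a} \<in> sets borel" by simp
qed

text \<open>
  Otherwise a sequence along which \<open>g\<close> tends to \<open>-\<infinity>\<close> would stay in \<open>K\<close>, and at an accumulation
  point \<open>g\<close> would be \<open>-\<infinity>\<close>. Outside \<open>K\<close> the value of \<open>g\<close> is \<open>\<infinity>\<close>.
\<close>

lemma lsc_fun_bounded_below:
  fixes g :: "'b::metric_space \<Rightarrow> ereal"
  assumes "lsc_fun g" "\<And>x. g x \<noteq> -\<infinity>" "compact K" "edom g \<subseteq> K"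
  obtains b where "0 \<le> b" "\<And>x. 0 \<le> g x + ereal b"
proof -
  have "\<exists>b\<ge>0. \<forall>x. 0 \<le> g x + ereal b"
  proof (rule ccontr)
    assume neg: "\<not> ?thesis"
    have "\<exists>x. g x < - ereal (real n)" for n
    proof -
      obtain x where "\<not> 0 \<le> g x + ereal (real n)" using neg by (meson of_nat_0_le_iff)
      then have "g x < - ereal (real n)" by (cases "g x") auto
      then show ?thesis by blast
    qed
    then obtain X where X: "\<And>n. g (X n) < - ereal (real n)" by metis
    have "X n \<in> K" for n using X[of n] assms(4) by (auto simp: edom_def intro!: subsetD[OF assms(4)])
    then obtain x r where r: "strict_mono (r :: nat \<Rightarrow> nat)" "(X \<circ> r) \<longlonglongrightarrow> x"
      using assms(3) unfolding compact_def by metis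
    have "g x \<le> - ereal (real N)" for N
    proof -
      have "g x \<le> liminf (\<lambda>n. g ((X \<circ> r) n))" by (rule lsc_fun_le_liminf[OF assms(1) r(2)])
      also have "\<dots> \<le> liminf (\<lambda>n. - ereal (real N))"
      proof (rule Liminf_mono, unfold eventually_sequentially, intro exI allI impI)
        fix n assume "N \<le> n"
        then have "N \<le> r n" using seq_suble[OF r(1), of n] by simp
        then show "g ((X \<circ> r) n) \<le> - ereal (real N)"
          using X[of "r n"] by (cases "g (X (r n))") auto
      qed
      finally show ?thesis by (simp add: Liminf_const)
    qed
    moreover obtain N where "- ereal (real N) < g x"
    proof (cases "g x")
      case (real s)
      obtain N where "- s < real N" using reals_Archimedean2 by blast
      then show ?thesis using that[of N] real by simp
    qed (use assms(2)[of x] that[of 0] in auto)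
    ultimately show False by (meson not_le)
  qed
  then show ?thesis using that by blast
qed

text \<open>
  For a lower bound \<open>- b\<close> of \<open>g\<close> nothing is truncated by \<^const>\<open>e2ennreal\<close>. Values in \<^typ>\<open>ennreal\<close>
  make the integral monotone and additive even where \<open>g\<close> is infinite.
\<close>

definition shifted :: "('b \<Rightarrow> ereal) \<Rightarrow> real \<Rightarrow> 'b \<Rightarrow> ennreal" where
  "shifted g b x = e2ennreal (g x + ereal b)"

lemma shifted_measurable:
  fixes g :: "'b::metric_space \<Rightarrow> ereal"
  assumes "lsc_fun g"
  shows "shifted g b \<in> borel_measurable borel"
proof -
  have [measurable]: "g \<in> borel_measurable borel" by (rule lsc_fun_borel_measurable[OF assms])
  show ?thesis unfolding shifted_def by measurable
qed

text \<open>
  Strict lower bounds of the shifted function are translated into strict lower bounds of \<open>g\<close>.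
\<close>

lemma shifted_lsc:
  fixes g :: "'b::metric_space \<Rightarrow> ereal"
  assumes "lsc_fun g" "\<And>x. 0 \<le> g x + ereal b" "X \<longlonglongrightarrow> x"
  shows "shifted g b x \<le> liminf (\<lambda>n. shifted g b (X n))"
  unfolding le_Liminf_iff
proof (intro allI impI)
  have less: "y < shifted g b v \<longleftrightarrow> enn2ereal y - ereal b < g v" for y v
    using assms(2)[of v] by (simp add: shifted_def less_ennreal.rep_eq enn2ereal_e2ennreal ereal_minus_less)
  fix y assume "y < shifted g b x"
  then have "enn2ereal y - ereal b < liminf (\<lambda>n. g (X n))"
    using lsc_fun_le_liminf[OF assms(1,3)] by (simp add: less)
  then show "eventually (\<lambda>n. y < shifted g b (X n)) sequentially"
    unfolding less by (rule less_LiminfD)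
qed

lemma shifted_convex:
  assumes "convex_fun g" "\<And>x. 0 \<le> g x + ereal b" "0 < t" "t < 1"
  shows "shifted g b ((1 - t) *\<^sub>R x + t *\<^sub>R y)
    \<le> ennreal (1 - t) * shifted g b x + ennreal t * shifted g b y"
proof -
  have conv: "g ((1 - t) *\<^sub>R x + t *\<^sub>R y) \<le> ereal (1 - t) * g x + ereal t * g y"
    using assms(1,3,4) by (simp add: convex_fun_def)
  have "g ((1 - t) *\<^sub>R x + t *\<^sub>R y) + ereal b
      \<le> ereal (1 - t) * (g x + ereal b) + ereal t * (g y + ereal b)"
    using conv assms(2)[of x] assms(2)[of y] assms(3,4)
    by (cases "g x"; cases "g y"; cases "g ((1 - t) *\<^sub>R x + t *\<^sub>R y)") (auto simp: algebra_simps)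
  then show ?thesis
    using assms(2-4)
    by (simp add: shifted_def less_eq_ennreal.rep_eq plus_ennreal.rep_eq times_ennreal.rep_eq
        enn2ereal_e2ennreal enn2ereal_ennreal)
qed

text \<open>
  The sublevel sets of the convex functional \<open>c \<mapsto> \<integral> k (c x)\<close> are convex, so a bound on the tail passes
  to its convex hull.
\<close>

lemma nn_integral_tail_hull_le:
  fixes k :: "'b::euclidean_space \<Rightarrow> ennreal"
  assumes [measurable]: "k \<in> borel_measurable borel"
    and convex: "\<And>t x y. 0 < t \<Longrightarrow> t < 1 \<Longrightarrow>
      k ((1 - t) *\<^sub>R x + t *\<^sub>R y) \<le> ennreal (1 - t) * k x + ennreal t * k y"
    and u: "\<And>i. u i \<in> borel_measurable M"
    and le: "\<And>i. n \<le> i \<Longrightarrow> (\<integral>\<^sup>+ x. k (u i x) \<partial>M) \<le> a"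
    and c: "c \<in> tail_hull u n"
  shows "(\<integral>\<^sup>+ x. k (c x) \<partial>M) \<le> a"
proof -
  have "c \<in> borel_measurable M \<and> (\<integral>\<^sup>+ x. k (c x) \<partial>M) \<le> a"
    using c
  proof induction
    case (comb c d t)
    then have [measurable]: "c \<in> borel_measurable M" "d \<in> borel_measurable M" by auto
    have "(\<integral>\<^sup>+ x. k ((1 - t) *\<^sub>R c x + t *\<^sub>R d x) \<partial>M)
        \<le> (\<integral>\<^sup>+ x. ennreal (1 - t) * k (c x) + ennreal t * k (d x) \<partial>M)"
      using comb by (intro nn_integral_mono convex) auto
    also have "\<dots> = ennreal (1 - t) * (\<integral>\<^sup>+ x. k (c x) \<partial>M) + ennreal t * (\<integral>\<^sup>+ x. k (d x) \<partial>M)"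
      by (simp add: nn_integral_add nn_integral_cmult)
    also have "\<dots> \<le> ennreal (1 - t) * a + ennreal t * a"
      using comb by (intro add_mono mult_left_mono) auto
    also have "\<dots> = a"
      using comb by (simp flip: distrib_right ennreal_plus)
    finally have "(\<integral>\<^sup>+ x. k ((1 - t) *\<^sub>R c x + t *\<^sub>R d x) \<partial>M) \<le> a" .
    moreover have "(\<lambda>x. (1 - t) *\<^sub>R c x + t *\<^sub>R d x) \<in> borel_measurable M" by measurable
    ultimately show ?case by blast
  qed (use u le in auto)
  then show ?thesis by blast
qed

text \<open>
  Convergence in the mean square gives almost everywhere convergence of a subsequence, to which the lower
  semicontinuity of \<open>k\<close> and Fatou's lemma apply.
\<close>

lemma nn_integral_le_of_norm_sq_limit:
  fixes c :: "nat \<Rightarrow> 'a \<Rightarrow> 'b::euclidean_space"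
  assumes k [measurable]: "k \<in> borel_measurable borel"
    and lsc: "\<And>X x. X \<longlonglongrightarrow> x \<Longrightarrow> k x \<le> liminf (\<lambda>n. k (X n))"
    and c [measurable]: "\<And>n. c n \<in> borel_measurable M" "w \<in> borel_measurable M"
    and int: "\<And>n. integrable M (\<lambda>x. (norm (c n x - w x))\<^sup>2)"
    and lim: "(\<lambda>n. LINT x|M. (norm (c n x - w x))\<^sup>2) \<longlonglongrightarrow> 0"
    and le: "\<And>n. N \<le> n \<Longrightarrow> (\<integral>\<^sup>+ x. k (c n x) \<partial>M) \<le> (a :: ennreal)"
  shows "(\<integral>\<^sup>+ x. k (w x) \<partial>M) \<le> a"
proof -
  have "\<exists>r::nat\<Rightarrow>nat. strict_mono r \<and> (AE x in M. (\<lambda>n. (norm (c (r n) x - w x))\<^sup>2) \<longlonglongrightarrow> 0)"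
    by (rule tendsto_L1_AE_subseq[OF int]) (use lim in simp)
  then obtain r where r: "strict_mono (r :: nat \<Rightarrow> nat)"
    and "AE x in M. (\<lambda>n. (norm (c (r n) x - w x))\<^sup>2) \<longlonglongrightarrow> 0"
    by blast
  from this(2) have ae: "AE x in M. (\<lambda>n. c (r n) x) \<longlonglongrightarrow> w x"
  proof eventually_elim
    case (elim x)
    then have "(\<lambda>n. sqrt ((norm (c (r n) x - w x))\<^sup>2)) \<longlonglongrightarrow> sqrt 0"
      by (rule tendsto_real_sqrt)
    then have "(\<lambda>n. c (r n) x - w x) \<longlonglongrightarrow> 0" by (simp add: tendsto_norm_zero_iff)
    then show ?case by (simp add: LIM_zero_iff)
  qed
  have "(\<integral>\<^sup>+ x. k (w x) \<partial>M) \<le> (\<integral>\<^sup>+ x. liminf (\<lambda>n. k (c (r n) x)) \<partial>M)"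
    by (rule nn_integral_mono_AE, use ae in eventually_elim) (rule lsc)
  also have "\<dots> \<le> liminf (\<lambda>n. \<integral>\<^sup>+ x. k (c (r n) x) \<partial>M)"
    by (rule nn_integral_liminf) measurable
  also have "\<dots> \<le> liminf (\<lambda>n. a)"
  proof (rule Liminf_mono, unfold eventually_sequentially, intro exI allI impI)
    fix n assume "N \<le> n"
    then have "N \<le> r n" using seq_suble[OF r, of n] by simp
    then show "(\<integral>\<^sup>+ x. k (c (r n) x) \<partial>M) \<le> a" by (rule le)
  qed
  finally show ?thesis by (simp add: Liminf_const)
qed

text \<open>
  Pointwise, \<open>(g + b) + g\<^sup>- = g\<^sup>+ + b\<close> holds in the nonnegative extended reals, even where \<open>g = \<infinity>\<close>. The
  integral of \<open>g\<^sup>-\<close> is at most \<open>b\<close> times the total measure, so it can be subtracted.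
\<close>

lemma (in finite_measure) ereal_integral_eq_shifted:
  assumes [measurable]: "g \<in> borel_measurable borel" "u \<in> borel_measurable M"
    and b: "0 \<le> b" "\<And>x. 0 \<le> g x + ereal b"
  shows "ereal_integral M (\<lambda>x. g (u x))
    = enn2ereal (\<integral>\<^sup>+ x. shifted g b (u x) \<partial>M) - ereal (b * measure M (space M))"
proof -
  let ?P = "\<integral>\<^sup>+ x. e2ennreal (g (u x)) \<partial>M" and ?N = "\<integral>\<^sup>+ x. e2ennreal (- g (u x)) \<partial>M"
  let ?K = "\<integral>\<^sup>+ x. shifted g b (u x) \<partial>M" and ?c = "b * measure M (space M)"
  have [measurable]: "(\<lambda>x. shifted g b (u x)) \<in> borel_measurable M"
    unfolding shifted_def by measurable
  have const: "(\<integral>\<^sup>+ x. ennreal b \<partial>M) = ennreal ?c"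
    using b(1) by (simp add: emeasure_eq_measure ennreal_mult)
  have "shifted g b y + e2ennreal (- g y) = e2ennreal (g y) + ennreal b" for y
  proof (cases "g y")
    case (real s)
    then show ?thesis
      using b(1) b(2)[of y] by (cases "0 \<le> s") (auto simp: shifted_def ennreal_neg simp flip: ennreal_plus)
  qed (use b(2)[of y] in \<open>auto simp: shifted_def e2ennreal_neg\<close>)
  then have "(\<integral>\<^sup>+ x. shifted g b (u x) + e2ennreal (- g (u x)) \<partial>M)
      = (\<integral>\<^sup>+ x. e2ennreal (g (u x)) + ennreal b \<partial>M)" by simp
  moreover have "(\<integral>\<^sup>+ x. shifted g b (u x) + e2ennreal (- g (u x)) \<partial>M) = ?K + ?N"
    by (rule nn_integral_add) measurable
  moreover have "(\<integral>\<^sup>+ x. e2ennreal (g (u x)) + ennreal b \<partial>M) = ?P + ennreal ?c"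
    unfolding const[symmetric] by (rule nn_integral_add) measurable
  ultimately have eq: "?K + ?N = ?P + ennreal ?c" by simp
  have "e2ennreal (- g y) \<le> ennreal b" for y
    using b(2)[of y] b(1) by (cases "g y") (auto simp: e2ennreal_neg intro: ennreal_leI)
  then have "?N \<le> ennreal ?c"
    unfolding const[symmetric] by (intro nn_integral_mono)
  then have "?N \<noteq> \<infinity>" by (auto simp: top_unique)
  have "0 \<le> ?c" using b(1) by simp
  with eq \<open>?N \<noteq> \<infinity>\<close> show ?thesis
    unfolding ereal_integral_def
    by (cases ?P; cases ?N; cases ?K)
      (auto simp: enn2ereal_ennreal simp flip: ennreal_plus)
qed

text \<open>
  With \<open>d = y - z\<close>, expanding \<open>0 \<le> \<parallel>(ys i - z) - d\<parallel>\<^sup>2\<close> bounds \<open>\<parallel>ys i - z\<parallel>\<^sup>2\<close> from below by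
  \<open>2 * ((ys i - z) \<bullet> d) - d \<bullet> d\<close>, which is affine in \<open>ys i\<close> and tends to \<open>\<parallel>d\<parallel>\<^sup>2\<close>.
\<close>

lemma weak_tendsto_norm_sq_le:
  fixes y :: "'y::real_inner"
  assumes "weak_tendsto ys y" "\<And>i. (norm (ys i - z))\<^sup>2 \<le> a i" "a \<longlonglongrightarrow> l"
  shows "(norm (y - z))\<^sup>2 \<le> l"
proof -
  let ?d = "y - z"
  have "(\<lambda>i. ys i \<bullet> ?d) \<longlonglongrightarrow> y \<bullet> ?d"
    using assms(1) bounded_linear_inner_left unfolding weak_tendsto_def by blast
  then have "(\<lambda>i. 2 * (ys i \<bullet> ?d - z \<bullet> ?d) - ?d \<bullet> ?d) \<longlonglongrightarrow> 2 * (y \<bullet> ?d - z \<bullet> ?d) - ?d \<bullet> ?d"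
    by (intro tendsto_diff tendsto_mult tendsto_const)
  moreover have "2 * (ys i \<bullet> ?d - z \<bullet> ?d) - ?d \<bullet> ?d \<le> a i" for i
  proof -
    have "0 \<le> (ys i - z - ?d) \<bullet> (ys i - z - ?d)" by simp
    then have "2 * ((ys i - z) \<bullet> ?d) - ?d \<bullet> ?d \<le> (ys i - z) \<bullet> (ys i - z)"
      by (simp only: inner_diff_left[of "ys i - z" ?d] inner_diff_right[of _ "ys i - z" ?d]
          inner_commute[of ?d "ys i - z"])
    then show ?thesis using assms(2)[of i] by (simp add: power2_norm_eq_inner inner_diff_left)
  qed
  ultimately have "2 * (y \<bullet> ?d - z \<bullet> ?d) - ?d \<bullet> ?d \<le> l"
    using assms(3) by (intro LIMSEQ_le) auto
  moreover have "y \<bullet> ?d - z \<bullet> ?d = ?d \<bullet> ?d" by (simp only: inner_diff_left)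
  ultimately show ?thesis by (simp add: power2_norm_eq_inner)
qed

section \<open>The direct method\<close>

theorem proposition2p1:
  fixes \<Omega> :: "(real ^ 'n) set"
    and M :: "(real ^ 'm) set"
    and g :: "real ^ 'm \<Rightarrow> ereal"
    and S :: "(real ^ 'n \<Rightarrow> real ^ 'm) \<Rightarrow> 'y::{real_inner, complete_space}"
    and z :: 'y
  assumes "open \<Omega>" and "bounded \<Omega>" and "\<Omega> \<noteq> {}"
    and "CARD('m) \<ge> 2"
    and "finite M"
    and "proper_fun g" and "convex_fun g" and "lsc_fun g"
    and "edom g = convex hull M"
    and "L2_respects \<Omega> S"
    and "weak_to_weak_continuous \<Omega> S"
  shows "\<exists>ubar\<in>L2 \<Omega>. \<forall>u\<in>L2 \<Omega>. energy \<Omega> S z g ubar \<le> energy \<Omega> S z g u"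
proof -
  have \<Omega>: "\<Omega> \<in> lmeasurable" using assms(1,2) by (rule lmeasurable_open[rotated])
  interpret finite_measure "lebesgue_on \<Omega>" using \<Omega> by (rule finite_measure_lebesgue_on)
  have K: "compact (convex hull M)" using assms(5) by (rule finite_imp_compact_convex_hull)
  obtain b where b: "0 \<le> b" "\<And>x. 0 \<le> g x + ereal b"
    by (rule lsc_fun_bounded_below[OF assms(8) _ K])
      (use assms(6,9) in \<open>auto simp: proper_fun_def\<close>)
  obtain R where R: "\<And>x. x \<in> convex hull M \<Longrightarrow> norm x \<le> R"
    using compact_imp_bounded[OF K] by (auto simp: bounded_iff)
  define k where "k = shifted g b"
  define G where "G u = (\<integral>\<^sup>+ x. k (u x) \<partial>lebesgue_on \<Omega>)" for u
  define s where "s u = 1 / 2 * (norm (S u - z))\<^sup>2" for u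
  have s_nonneg: "0 \<le> s u" for u by (simp add: s_def)
  have k [measurable]: "k \<in> borel_measurable borel"
    unfolding k_def by (rule shifted_measurable[OF assms(8)])
  define F where "F u = ennreal (s u) + G u" for u
  have energy: "energy \<Omega> S z g u
      = enn2ereal (F u) - ereal (b * measure (lebesgue_on \<Omega>) (space (lebesgue_on \<Omega>)))"
    if "u \<in> L2 \<Omega>" for u
  proof -
    have "ereal_integral (lebesgue_on \<Omega>) (\<lambda>x. g (u x))
        = enn2ereal (G u) - ereal (b * measure (lebesgue_on \<Omega>) (space (lebesgue_on \<Omega>)))"
      unfolding G_def k_def
      by (rule ereal_integral_eq_shifted[OF lsc_fun_borel_measurable[OF assms(8)] _ b])
        (use that in \<open>simp add: L2_def\<close>)
    then show ?thesis
      using s_nonneg[of u] unfolding energy_def F_def s_def[symmetric]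
      by (cases "G u") (auto simp: enn2ereal_ennreal simp flip: ennreal_plus)
  qed
  define \<gamma> where "\<gamma> = (INF u\<in>L2 \<Omega>. F u)"
  \<comment> \<open>\<open>F\<close> differs from the energy by a finite constant, so it suffices to attain its infimum.\<close>
  have "\<exists>w\<in>L2 \<Omega>. F w \<le> \<gamma>"
  proof (cases "\<gamma> = \<infinity>")
    case True
    moreover have "(\<lambda>x. 0) \<in> L2 \<Omega>" by (simp add: L2_def)
    ultimately show ?thesis by auto
  next
    case False
    then obtain \<gamma>' where \<gamma>': "\<gamma> = ennreal \<gamma>'" "0 \<le> \<gamma>'" by (cases \<gamma>) auto
    have "\<exists>u\<in>L2 \<Omega>. F u < ennreal (\<gamma>' + 1 / real (Suc i))" for i
    proof -
      have "\<gamma> < ennreal (\<gamma>' + 1 / real (Suc i))" using \<gamma>' by (simp add: ennreal_less_iff)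
      then show ?thesis unfolding \<gamma>_def INF_less_iff .
    qed
    then obtain u where u: "\<And>i. u i \<in> L2 \<Omega>" "\<And>i. F (u i) < ennreal (\<gamma>' + 1 / real (Suc i))"
      by metis
    define p where "p i = enn2real (G (u i))" for i
    have Gp: "G (u i) = ennreal (p i)" for i
      using u(2)[of i] by (cases "G (u i)") (auto simp: p_def F_def)
    have p0: "0 \<le> p i" for i by (simp add: p_def)
    have sp: "s (u i) + p i < \<gamma>' + 1 / real (Suc i)" for i
      using u(2)[of i] p0[of i] s_nonneg[of "u i"]
      by (simp add: F_def Gp ennreal_less_iff flip: ennreal_plus)
    have bound: "(LINT x|lebesgue_on \<Omega>. (norm (u i x))\<^sup>2)
        \<le> R\<^sup>2 * measure (lebesgue_on \<Omega>) (space (lebesgue_on \<Omega>))" for i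
    proof -
      have [measurable]: "u i \<in> borel_measurable (lebesgue_on \<Omega>)" using u(1) by (simp add: L2_def)
      have "AE x in lebesgue_on \<Omega>. k (u i x) \<noteq> \<infinity>"
        using Gp[of i] by (intro nn_integral_PInf_AE) (auto simp: G_def)
      then have "AE x in lebesgue_on \<Omega>. (norm (u i x))\<^sup>2 \<le> R\<^sup>2"
      proof eventually_elim
        case (elim x)
        then have "u i x \<in> edom g"
          by (cases "g (u i x)") (auto simp: k_def shifted_def edom_def)
        then show ?case using R assms(9) by (intro power_mono) auto
      qed
      then have "(LINT x|lebesgue_on \<Omega>. (norm (u i x))\<^sup>2) \<le> (LINT x|lebesgue_on \<Omega>. R\<^sup>2)"
        using u(1)[of i] by (intro integral_mono_AE) (auto simp: L2_def)
      then show ?thesis by (simp add: mult.commute)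
    qed
    have "\<bar>p i\<bar> \<le> \<gamma>' + 1" for i
    proof -
      have "1 / real (Suc i) \<le> 1" by simp
      then show ?thesis using sp[of i] p0[of i] s_nonneg[of "u i"] by linarith
    qed
    \<comment> \<open>The integral terms are made convergent before the weak limit is taken. The lower
       semicontinuity of each term can then be used separately: the integral term converges
       to \<open>l\<close>, which leaves at most \<open>\<gamma>' - l\<close> for the other term in the limit.\<close>
    then obtain l r where r: "strict_mono (r :: nat \<Rightarrow> nat)" and l: "(\<lambda>i. p (r i)) \<longlonglongrightarrow> l"
      using bounded_real_convergent_subseq by blast
    obtain q c w where q: "strict_mono (q :: nat \<Rightarrow> nat)"
      and weak: "L2_weak_tendsto \<Omega> (\<lambda>i. u (r (q i))) w"
      and cL2: "\<And>n. c n \<in> L2 \<Omega>" and c: "\<And>n. c n \<in> tail_hull (\<lambda>i. u (r i)) n"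
      and lim: "(\<lambda>n. LINT x|lebesgue_on \<Omega>. (norm (c n x - w x))\<^sup>2) \<longlonglongrightarrow> 0"
      by (rule L2_bounded_weakly_convergent_subseq[OF \<Omega>, of "\<lambda>i. u (r i)"])
        (use u(1) bound in auto)
    have w: "w \<in> L2 \<Omega>" using weak by (simp add: L2_weak_tendsto_def)
    have meas: "\<And>i. u i \<in> borel_measurable (lebesgue_on \<Omega>)"
      "\<And>n. c n \<in> borel_measurable (lebesgue_on \<Omega>)" "w \<in> borel_measurable (lebesgue_on \<Omega>)"
      using u(1) cL2 w by (auto simp: L2_def)
    have int: "integrable (lebesgue_on \<Omega>) (\<lambda>x. (norm (c n x - w x))\<^sup>2)" for n
      by (rule integrable_norm_sq_diff) (use cL2[of n] w in \<open>auto simp: L2_def\<close>)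
    have "0 \<le> l" using l p0 by (intro LIMSEQ_le_const) auto
    have "G w \<le> ennreal l"
    proof (rule ennreal_le_epsilon)
      fix e :: real assume "0 < e"
      then obtain N where "\<And>i. N \<le> i \<Longrightarrow> \<bar>p (r i) - l\<bar> < e"
        using LIMSEQ_D[OF l, of e] by auto
      then have N: "G (u (r i)) \<le> ennreal (l + e)" if "N \<le> i" for i
        unfolding Gp using that by (intro ennreal_leI) fastforce
      have "G (c n) \<le> ennreal (l + e)" if "N \<le> n" for n
        unfolding G_def
      proof (rule nn_integral_tail_hull_le[OF k _ _ _ c])
        show "(\<integral>\<^sup>+ x. k (u (r i) x) \<partial>lebesgue_on \<Omega>) \<le> ennreal (l + e)" if "n \<le> i" for i
          using N[of i] \<open>N \<le> n\<close> that by (simp add: G_def)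
        show "k ((1 - t) *\<^sub>R x + t *\<^sub>R y) \<le> ennreal (1 - t) * k x + ennreal t * k y"
          if "0 < t" "t < 1" for t x y
          unfolding k_def by (rule shifted_convex[OF assms(7) b(2) that])
      qed (rule meas)
      then have "G w \<le> ennreal (l + e)"
        unfolding G_def
        by (intro nn_integral_le_of_norm_sq_limit[OF k _ meas(2,3) int lim])
          (use shifted_lsc[OF assms(8) b(2)] in \<open>auto simp: k_def\<close>)
      then show "G w \<le> ennreal l + ennreal e"
        using \<open>0 \<le> l\<close> \<open>0 < e\<close> by (simp flip: ennreal_plus)
    qed
    moreover have "s w \<le> \<gamma>' - l"
    proof -
      have "(norm (S w - z))\<^sup>2 \<le> 2 * (\<gamma>' + 0 - l)"
      proof (rule weak_tendsto_norm_sq_le)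
        show "weak_tendsto (\<lambda>i. S (u (r (q i)))) (S w)"
          using assms(11) weak by (simp add: weak_to_weak_continuous_def)
        show "(norm (S (u (r (q i))) - z))\<^sup>2 \<le> 2 * (\<gamma>' + 1 / real (Suc (r (q i))) - p (r (q i)))" for i
          using sp[of "r (q i)"] by (simp add: s_def)
        have "(\<lambda>i. 1 / real (Suc (r (q i)))) \<longlonglongrightarrow> 0"
          using LIMSEQ_subseq_LIMSEQ[OF LIMSEQ_Suc[OF lim_1_over_n] strict_mono_o[OF r q]]
          by (simp add: o_def)
        moreover have "(\<lambda>i. p (r (q i))) \<longlonglongrightarrow> l"
          using LIMSEQ_subseq_LIMSEQ[OF l q] by (simp add: o_def)
        ultimately show "(\<lambda>i. 2 * (\<gamma>' + 1 / real (Suc (r (q i))) - p (r (q i)))) \<longlonglongrightarrow> 2 * (\<gamma>' + 0 - l)"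
          by (intro tendsto_intros)
      qed
      then show ?thesis by (simp add: s_def)
    qed
    ultimately have "F w \<le> ennreal (\<gamma>' - l) + ennreal l"
      unfolding F_def by (intro add_mono ennreal_leI)
    also have "\<dots> = \<gamma>"
      using \<open>s w \<le> \<gamma>' - l\<close> s_nonneg[of w] \<open>0 \<le> l\<close> \<gamma>' by (simp flip: ennreal_plus)
    finally show ?thesis using w by blast
  qed
  then obtain w where w: "w \<in> L2 \<Omega>" "F w \<le> \<gamma>" by blast
  have "energy \<Omega> S z g w \<le> energy \<Omega> S z g u" if "u \<in> L2 \<Omega>" for u
  proof -
    have "F w \<le> F u" using w(2) INF_lower[OF that, of F] unfolding \<gamma>_def by (rule order_trans)
    then show ?thesis
      unfolding energy[OF w(1)] energy[OF that] by (intro ereal_minus_mono) (simp_all add: less_eq_ennreal.rep_eq)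
  qed
  then show ?thesis using w(1) by blast
qed

end
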